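(* The value of $\mathrm{cdim}(G-e)-\mathrm{cdim}(G)$ can be arbitrarily large, as $G$ varies; that is, for every integer $N$ there exist a connected graph $G$ and an edge $e$ of $G$ such that $G-e$ is connected and $\mathrm{cdim}(G-e)-\mathrm{cdim}(G)\ge N$.
   Context: All graphs are finite, simple, undirected, of order at least two. $G-e$ is the graph obtained by deleting the edge $e$ (keeping all vertices). A set $S\subseteq V(G)$ is a resolving set of a connected graph $G$ if for every pair of distinct vertices $x,y$ of $G$ there is $z\in S$ with $d(x,z)\ne d(y,z)$ ($d$ is the shortest-path distance); it is a connected resolving set if moreover the induced subgraph $G[S]$ is connected. $\mathrm{cdim}(G)$ is the minimum cardinality of a connected resolving set of $G$. *)

theory Defs
  imports "Graph_Theory.Graph_Theory"
begin

text \<open>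
  A finite simple undirected graph is a \<^locale>\<open>pair_graph\<close>: a finite, loop-free, symmetric
  digraph whose arcs are pairs of vertices. An undirected edge \<open>{u, v}\<close> is thus the pair of
  arcs \<open>(u, v)\<close> and \<open>(v, u)\<close>, and deleting it has to remove both.
\<close>

definition delete_edge :: "'a pair_pre_digraph \<Rightarrow> 'a \<Rightarrow> 'a \<Rightarrow> 'a pair_pre_digraph" where
  "delete_edge G u v = G\<lparr>parcs := parcs G - {(u, v), (v, u)}\<rparr>"

definition gdist :: "'a pair_pre_digraph \<Rightarrow> 'a \<Rightarrow> 'a \<Rightarrow> ereal" where
  "gdist G u v = wf_digraph.\<mu> (with_proj G) (\<lambda>_. 1) u v"

definition resolving_set :: "'a pair_pre_digraph \<Rightarrow> 'a set \<Rightarrow> bool" where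
  "resolving_set G S \<longleftrightarrow>
     S \<subseteq> pverts G \<and>
     (\<forall>x\<in>pverts G. \<forall>y\<in>pverts G. x \<noteq> y \<longrightarrow> (\<exists>z\<in>S. gdist G x z \<noteq> gdist G y z))"

text \<open>
  Connectedness is qualified because \<^theory>\<open>Complex_Main\<close> has a topological notion of the
  same name.
\<close>

definition connected_resolving_set :: "'a pair_pre_digraph \<Rightarrow> 'a set \<Rightarrow> bool" where
  "connected_resolving_set G S \<longleftrightarrow>
     resolving_set G S \<and> Digraph_Component.connected (with_proj G \<restriction> S)"

definition cdim :: "'a pair_pre_digraph \<Rightarrow> nat" where
  "cdim G = (LEAST k. \<exists>S. connected_resolving_set G S \<and> card S = k)"

lemma pair_graph_delete_edge:
  assumes "pair_graph G"
  shows "pair_graph (delete_edge G u v)"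
proof -
  interpret pair_graph G by fact
  have "symmetric (with_proj (delete_edge G u v))"
    using pair_sym_arcs by (auto simp: symmetric_def sym_def delete_edge_def)
  then show ?thesis
    by unfold_locales
      (auto simp: delete_edge_def dest: in_arcsD1 in_arcsD2 no_loops'
        intro: pair_finite_verts pair_finite_arcs)
qed

text \<open>The minimum in \<^const>\<open>cdim\<close> ranges over a nonempty set, so \<open>LEAST\<close> is meaningful.\<close>

lemma connected_resolving_set_pverts:
  assumes "pair_graph G" "Digraph_Component.connected (with_proj G)"
  shows "connected_resolving_set G (pverts G)"
proof -
  interpret pair_graph G by fact
  have self: "gdist G x x \<le> 0" if "x \<in> pverts G" for x
  proof -
    have "awalk x [] x" using that by (simp add: awalk_Nil_iff)
    from min_cost_le_walk_cost[OF this, of "\<lambda>_. 1"]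
    show ?thesis by (simp add: gdist_def zero_ereal_def)
  qed
  have other: "1 \<le> gdist G y x" if "x \<noteq> y" for x y
    unfolding gdist_def \<mu>_def
  proof (rule INF_greatest)
    fix p assume "p \<in> {p. awalk y p x}"
    with that have "p \<noteq> []" by (auto simp: awalk_Nil_iff)
    then show "1 \<le> ereal (awalk_cost (\<lambda>_. 1) p)"
      by (cases p) (auto simp: awalk_cost_def one_ereal_def intro!: sum_list_nonneg)
  qed
  have "\<exists>z\<in>pverts G. gdist G x z \<noteq> gdist G y z"
    if "x \<in> pverts G" "y \<in> pverts G" "x \<noteq> y" for x y
  proof
    show "x \<in> pverts G" by fact
    show "gdist G x x \<noteq> gdist G y x"
      using order_trans[OF other[OF that(3)], of 0] self[OF that(1)] by auto
  qed
  moreover have "with_proj G \<restriction> pverts G = with_proj G"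
    by (auto simp: induce_subgraph_def with_proj_def dest: in_arcsD1 in_arcsD2)
  ultimately show ?thesis
    using assms by (simp add: connected_resolving_set_def resolving_set_def)
qed

end

theory Submission
  imports Defs
begin

text \<open>
  Hang two leaves on each of two vertices \<open>a\<close> and \<open>b\<close>. Two leaves with the same neighbour have
  equal distances to every third vertex, so a resolving set contains a leaf at \<open>a\<close> and a leaf at
  \<open>b\<close>; if it is connected, it therefore also contains all vertices of some path from \<open>a\<close> to \<open>b\<close>
  (lemmas \<open>false_twins_meet\<close> and \<open>path_subset_connected_resolving_set\<close>). When the only path
  between \<open>a\<close> and \<open>b\<close> is long, this makes the connected metric dimension large.

  The edge \<open>{a, b}\<close> is a shortcut. It turns the path with \<open>2 * n\<close> edges into an odd cycle, and
  \<open>a\<close>, \<open>b\<close> and the four leaves now induce a connected subgraph. An odd cycle is resolved by the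
  distances to two adjacent vertices, so these six vertices form a connected resolving set
  (lemma \<open>cdim_shortcut_le\<close>). Deleting the shortcut hence raises the dimension
  from at most \<open>6\<close> to at least \<open>2 * n + 1\<close>.
\<close>

section \<open>Distances\<close>

text \<open>
  A distance function is recognised locally: changing by at most one along an arc bounds every
  walk from below, and descending neighbours yield a walk that attains the bound.
\<close>

lemma gdist_eqI:
  fixes f :: "'a \<Rightarrow> nat"
  assumes "pair_wf_digraph G"
    and zero: "f z = 0"
    and lip: "\<And>x y. (x, y) \<in> parcs G \<Longrightarrow> f x \<le> Suc (f y)"
    and desc: "\<And>x. x \<in> pverts G \<Longrightarrow> x \<noteq> z \<Longrightarrow> \<exists>y. (x, y) \<in> parcs G \<and> f x = Suc (f y)"
    and x: "x \<in> pverts G"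
  shows "gdist G x z = ereal (real (f x))"
proof -
  interpret pair_wf_digraph G by fact
  have lower: "real (f x) \<le> awalk_cost (\<lambda>_. 1) p" if "awalk x p z" for x p
    using that
  proof (induction p arbitrary: x)
    case Nil
    then show ?case by (simp add: awalk_Nil_iff zero)
  next
    case (Cons e p)
    from Cons.prems have e: "e \<in> parcs G" "fst e = x" and w: "awalk (snd e) p z"
      by (auto simp: awalk_Cons_iff)
    from e have "f x \<le> Suc (f (snd e))" using lip[of x "snd e"] by (metis prod.collapse)
    with Cons.IH[OF w] show ?case by simp
  qed
  have upper: "\<exists>p. awalk x p z \<and> awalk_cost (\<lambda>_. 1) p = real (f x)" if "x \<in> pverts G" for x
    using that
  proof (induction "f x" arbitrary: x rule: less_induct)
    case less
    show ?case
    proof (cases "x = z")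
      case True
      with less.prems show ?thesis
        by (intro exI[of _ "[]"]) (simp add: awalk_Nil_iff zero)
    next
      case False
      with desc less.prems obtain y where y: "(x, y) \<in> parcs G" "f x = Suc (f y)" by blast
      then obtain p where "awalk y p z" "awalk_cost (\<lambda>_. 1) p = real (f y)"
        using less.hyps[of y] in_arcsD2 by force
      with y show ?thesis
        by (intro exI[of _ "(x, y) # p"]) (auto simp: awalk_Cons_iff dest: in_arcsD1)
    qed
  qed
  from upper[OF x] obtain p where p: "awalk x p z" "awalk_cost (\<lambda>_. 1) p = real (f x)" by blast
  show ?thesis
  proof (rule antisym)
    show "gdist G x z \<le> ereal (real (f x))"
      using min_cost_le_walk_cost[OF p(1), of "\<lambda>_. 1"] p(2) by (simp add: gdist_def)
    show "ereal (real (f x)) \<le> gdist G x z"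
      unfolding gdist_def \<mu>_def by (rule INF_greatest) (auto dest: lower)
  qed
qed

lemma gdist_self_neq:
  assumes "pair_wf_digraph G" "x \<in> pverts G" "x \<noteq> y"
  shows "gdist G x x \<noteq> gdist G y x"
proof -
  interpret pair_wf_digraph G by fact
  have "gdist G x x \<le> ereal 0"
    using min_cost_le_walk_cost[of x "[]" x "\<lambda>_. 1"] assms(2)
    by (simp add: gdist_def awalk_Nil_iff)
  also have "ereal 0 < ereal 1" by simp
  also have "ereal 1 \<le> gdist G y x"
    unfolding gdist_def \<mu>_def
  proof (rule INF_greatest)
    fix p assume "p \<in> {p. awalk y p x}"
    with assms(3) obtain e q where "p = e # q"
      by (cases p) (auto simp: awalk_Nil_iff)
    moreover have "0 \<le> awalk_cost (\<lambda>_. 1) q"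
      unfolding awalk_cost_def by (rule sum_list_nonneg) auto
    ultimately show "ereal 1 \<le> ereal (awalk_cost (\<lambda>_. 1) p)" by simp
  qed
  finally show ?thesis by simp
qed

text \<open>A nonempty walk starting in \<open>y\<close> can be started in \<open>x\<close> instead, at the same cost.\<close>

lemma gdist_mono_neighbours:
  assumes "pair_wf_digraph G"
    and nb: "\<And>w. (y, w) \<in> parcs G \<Longrightarrow> (x, w) \<in> parcs G"
    and "z \<noteq> y"
  shows "gdist G x z \<le> gdist G y z"
proof -
  interpret pair_wf_digraph G by fact
  show ?thesis
    unfolding gdist_def[of G y] \<mu>_def
  proof (rule INF_greatest)
    fix p assume "p \<in> {p. awalk y p z}"
    then have p: "awalk y p z" by simp
    with \<open>z \<noteq> y\<close> obtain e q where q: "p = e # q"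
      by (cases p) (auto simp: awalk_Nil_iff)
    with p have e: "(y, snd e) \<in> parcs G" and w: "awalk (snd e) q z"
      by (auto simp: awalk_Cons_iff)
    with nb[OF e] have "awalk x ((x, snd e) # q) z"
      by (auto simp: awalk_Cons_iff dest: in_arcsD1)
    from min_cost_le_walk_cost[OF this, of "\<lambda>_. 1"] q
    show "gdist G x z \<le> ereal (awalk_cost (\<lambda>_. 1) p)" by (simp add: gdist_def)
  qed
qed

lemma false_twins_meet:
  assumes "pair_wf_digraph G" "resolving_set G S"
    and "x \<in> pverts G" "y \<in> pverts G" "x \<noteq> y"
    and nb: "\<And>w. (x, w) \<in> parcs G \<longleftrightarrow> (y, w) \<in> parcs G"
  shows "x \<in> S \<or> y \<in> S"
proof -
  from assms obtain z where z: "z \<in> S" "gdist G x z \<noteq> gdist G y z"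
    unfolding resolving_set_def by blast
  have "z = x \<or> z = y"
  proof (rule ccontr)
    assume "\<not> (z = x \<or> z = y)"
    then have "gdist G x z = gdist G y z"
      using nb by (intro antisym gdist_mono_neighbours[OF assms(1)]) auto
    with z show False by simp
  qed
  with z show ?thesis by blast
qed

section \<open>Connectedness of induced subgraphs\<close>

lemma induce_pverts:
  assumes "pair_wf_digraph G"
  shows "with_proj G \<restriction> pverts G = with_proj G"
proof -
  interpret pair_wf_digraph G by fact
  show ?thesis
    by (auto simp: induce_subgraph_def with_proj_def dest: in_arcsD1 in_arcsD2)
qed

lemma connected_induce_conv:
  assumes "pair_graph G" "S \<subseteq> pverts G"
  shows "Digraph_Component.connected (with_proj G \<restriction> S) \<longleftrightarrow>
    S \<noteq> {} \<and> (\<forall>x\<in>S. \<forall>y\<in>S. (x, y) \<in> rtrancl_on S (parcs G \<inter> S \<times> S))"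
proof -
  interpret pair_graph G by fact
  interpret I: wf_digraph "with_proj G \<restriction> S"
    using assms(2) by (intro wf_digraphI_induced[OF induced_induce]) simp
  have "arcs_ends (with_proj G \<restriction> S) = parcs G \<inter> S \<times> S"
    by (force simp: arcs_ends_conv induce_subgraph_def)
  moreover have "(parcs G \<inter> S \<times> S)\<^sup>s = parcs G \<inter> S \<times> S"
    using pair_sym_arcs by (auto simp: symcl_def symmetric_def sym_def)
  ultimately show ?thesis by (simp add: connected_conv)
qed

text \<open>The measure \<open>f\<close> makes iterated passage to smaller neighbours end at the root.\<close>

lemma connected_induceI:
  fixes f :: "'a \<Rightarrow> nat"
  assumes "pair_graph G" "S \<subseteq> pverts G" "r \<in> S"
    and desc: "\<And>x. x \<in> S \<Longrightarrow> x \<noteq> r \<Longrightarrow> \<exists>y\<in>S. (x, y) \<in> parcs G \<and> f y < f x"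
  shows "Digraph_Component.connected (with_proj G \<restriction> S)"
proof -
  interpret pair_graph G by fact
  let ?R = "parcs G \<inter> S \<times> S"
  have root: "(x, r) \<in> rtrancl_on S ?R \<and> (r, x) \<in> rtrancl_on S ?R" if "x \<in> S" for x
    using that
  proof (induction "f x" arbitrary: x rule: less_induct)
    case less
    show ?case
    proof (cases "x = r")
      case True
      with \<open>r \<in> S\<close> show ?thesis by simp
    next
      case False
      with desc less.prems obtain y where y: "y \<in> S" "(x, y) \<in> parcs G" "f y < f x" by blast
      then have "(y, x) \<in> parcs G" using pair_sym_arcs by (auto simp: symmetric_def sym_def)
      with y less.prems less.hyps[OF y(3,1)] show ?thesis
        by (auto intro: converse_rtrancl_on_into_rtrancl_on rtrancl_on_into_rtrancl_on)
    qed
  qed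
  with assms show ?thesis
    by (auto simp: connected_induce_conv intro: rtrancl_on_trans)
qed

lemma connected_induce_closed:
  assumes "pair_graph G" "S \<subseteq> pverts G" "Digraph_Component.connected (with_proj G \<restriction> S)"
    and "x \<in> S" "x \<in> A" "y \<in> S"
    and closed: "\<And>u w. u \<in> A \<Longrightarrow> u \<in> S \<Longrightarrow> w \<in> S \<Longrightarrow> (u, w) \<in> parcs G \<Longrightarrow> w \<in> A"
  shows "y \<in> A"
proof -
  have "(x, y) \<in> rtrancl_on S (parcs G \<inter> S \<times> S)"
    using assms by (simp add: connected_induce_conv)
  then show ?thesis
    by (induction rule: rtrancl_on_induct) (use assms in auto)
qed

section \<open>A path with forked ends, with and without a shortcut\<close>

definition forked_path_arcs :: "nat \<Rightarrow> (nat \<times> nat) set" where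
  "forked_path_arcs m = {(x, y). y = Suc x \<and> x < m} \<union>
     {(0, m + 1), (0, m + 2), (m, m + 3), (m, m + 4)}"

definition forked_path :: "nat \<Rightarrow> nat pair_pre_digraph" where
  "forked_path m = \<lparr>pverts = {..m + 4}, parcs = symcl (forked_path_arcs m)\<rparr>"

definition shortcut_path :: "nat \<Rightarrow> nat pair_pre_digraph" where
  "shortcut_path m = \<lparr>pverts = {..m + 4}, parcs = symcl (insert (0, m) (forked_path_arcs m))\<rparr>"

lemma pverts_forked [simp]:
  "pverts (forked_path m) = {..m + 4}" "pverts (shortcut_path m) = {..m + 4}"
  by (simp_all add: forked_path_def shortcut_path_def)

lemma symcl_iff: "(x, y) \<in> symcl R \<longleftrightarrow> (x, y) \<in> R \<or> (y, x) \<in> R"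
  by (force simp: symcl_def)

lemma forked_arc_iff:
  "(x, y) \<in> parcs (forked_path m) \<longleftrightarrow>
     y = Suc x \<and> x < m \<or> x = Suc y \<and> y < m \<or>
     x = 0 \<and> (y = m + 1 \<or> y = m + 2) \<or> y = 0 \<and> (x = m + 1 \<or> x = m + 2) \<or>
     x = m \<and> (y = m + 3 \<or> y = m + 4) \<or> y = m \<and> (x = m + 3 \<or> x = m + 4)"
  by (simp add: forked_path_def forked_path_arcs_def symcl_iff) blast

lemma shortcut_arc_iff:
  "(x, y) \<in> parcs (shortcut_path m) \<longleftrightarrow>
     (x, y) \<in> parcs (forked_path m) \<or> x = 0 \<and> y = m \<or> x = m \<and> y = 0"
  by (simp add: forked_path_def shortcut_path_def symcl_iff) blast

lemma pair_graph_shortcut: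
  assumes "0 < m"
  shows "pair_graph (shortcut_path m)"
proof -
  have sub: "parcs (shortcut_path m) \<subseteq> {..m + 4} \<times> {..m + 4}"
    by (auto simp: shortcut_arc_iff forked_arc_iff)
  then have "finite (parcs (shortcut_path m))"
    by (rule finite_subset) simp
  moreover have "symmetric (with_proj (shortcut_path m))"
    unfolding symmetric_def sym_def by (auto simp: shortcut_arc_iff forked_arc_iff)
  moreover have "x \<noteq> y" if "(x, y) \<in> parcs (shortcut_path m)" for x y
    using that assms by (auto simp: shortcut_arc_iff forked_arc_iff)
  ultimately show ?thesis
    using sub by unfold_locales force+
qed

lemma delete_shortcut:
  assumes "2 \<le> m"
  shows "delete_edge (shortcut_path m) 0 m = forked_path m"
proof -
  have "(0, m) \<notin> parcs (forked_path m)" "(m, 0) \<notin> parcs (forked_path m)"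
    using assms by (auto simp: forked_arc_iff)
  then have "parcs (shortcut_path m) - {(0, m), (m, 0)} = parcs (forked_path m)"
    by (auto simp: shortcut_arc_iff)
  then show ?thesis
    by (simp add: delete_edge_def shortcut_path_def forked_path_def)
qed

lemma pair_graph_forked:
  assumes "2 \<le> m"
  shows "pair_graph (forked_path m)"
  using pair_graph_delete_edge[OF pair_graph_shortcut, of m 0 m] assms
  by (simp add: delete_shortcut)

text \<open>
  In this numbering every vertex except \<open>0\<close> has a smaller neighbour, so the vertex itself can
  serve as the measure of descent.
\<close>

lemma connected_if_forked_path_subset:
  assumes pg: "pair_graph G" and verts: "pverts G = {..m + 4}"
    and arcs: "parcs (forked_path m) \<subseteq> parcs G"
  shows "Digraph_Component.connected (with_proj G)"
proof -
  interpret pair_graph G by (fact pg)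
  have "\<exists>y\<in>pverts G. (x, y) \<in> parcs G \<and> y < x" if x: "x \<in> pverts G" "x \<noteq> 0" for x
  proof -
    have "\<exists>y. (x, y) \<in> parcs (forked_path m) \<and> y < x"
    proof (cases "x \<le> m")
      case True
      with x show ?thesis by (intro exI[of _ "x - 1"]) (auto simp: forked_arc_iff)
    next
      case False
      with x verts have "x = m + 1 \<or> x = m + 2 \<or> x = m + 3 \<or> x = m + 4" by auto
      then have "(x, if x \<le> m + 2 then 0 else m) \<in> parcs (forked_path m)"
        by (auto simp: forked_arc_iff)
      moreover have "(if x \<le> m + 2 then 0 else m) < x" using False by simp
      ultimately show ?thesis by blast
    qed
    with arcs show ?thesis by (auto dest: in_arcsD2)
  qed
  then have "Digraph_Component.connected (with_proj G \<restriction> pverts G)"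
    by (intro connected_induceI[OF pg, where f = id and r = 0]) (auto simp: verts)
  then show ?thesis by (simp only: induce_pverts[OF pair_wf_digraph_axioms])
qed

lemma connected_forked:
  assumes "2 \<le> m"
  shows "Digraph_Component.connected (with_proj (forked_path m))"
  using connected_if_forked_path_subset[OF pair_graph_forked[OF assms] pverts_forked(1)] by simp

lemma connected_shortcut:
  assumes "2 \<le> m"
  shows "Digraph_Component.connected (with_proj (shortcut_path m))"
proof (rule connected_if_forked_path_subset[OF pair_graph_shortcut pverts_forked(2)])
  show "0 < m" using assms by simp
  show "parcs (forked_path m) \<subseteq> parcs (shortcut_path m)" by (auto simp: shortcut_arc_iff)
qed

section \<open>The dimension without the shortcut\<close>

text \<open>
  Every path vertex \<open>i\<close> separates the leaves at \<open>0\<close> from those at \<open>m\<close>, and a connected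
  resolving set has members of both kinds.
\<close>

lemma path_subset_connected_resolving_set:
  assumes m: "2 \<le> m" and crs: "connected_resolving_set (forked_path m) S"
  shows "{..m} \<subseteq> S"
proof
  fix i assume "i \<in> {..m}"
  then have i: "i \<le> m" by simp
  have pg: "pair_graph (forked_path m)" using m by (rule pair_graph_forked)
  interpret pair_graph "forked_path m" by (fact pg)
  from crs have res: "resolving_set (forked_path m) S"
    and sub: "S \<subseteq> pverts (forked_path m)"
    and con: "Digraph_Component.connected (with_proj (forked_path m) \<restriction> S)"
    by (auto simp: connected_resolving_set_def resolving_set_def)
  have "m + 1 \<in> S \<or> m + 2 \<in> S"
    using m by (intro false_twins_meet[OF pair_wf_digraph_axioms res]) (auto simp: forked_arc_iff)
  then obtain a where a: "a \<in> S" "a = m + 1 \<or> a = m + 2" by blast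
  have "m + 3 \<in> S \<or> m + 4 \<in> S"
    using m by (intro false_twins_meet[OF pair_wf_digraph_axioms res]) (auto simp: forked_arc_iff)
  then obtain b where b: "b \<in> S" "b = m + 3 \<or> b = m + 4" by blast
  show "i \<in> S"
  proof (rule ccontr)
    assume "i \<notin> S"
    let ?A = "{..<i} \<union> {m + 1, m + 2}"
    have closed: "w \<in> ?A"
      if "u \<in> ?A" "w \<in> S" "(u, w) \<in> parcs (forked_path m)" for u w
    proof -
      from that(2) \<open>i \<notin> S\<close> have "w \<noteq> i" by blast
      with that(1,3) i show ?thesis by (auto simp: forked_arc_iff)
    qed
    from a(2) have "a \<in> ?A" by blast
    then have "b \<in> ?A"
      by (rule connected_induce_closed[OF pg sub con a(1) _ b(1) closed])
    with b i show False by auto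
  qed
qed

lemma cdim_forked_ge:
  assumes "2 \<le> m"
  shows "m + 1 \<le> cdim (forked_path m)"
proof -
  have pg: "pair_graph (forked_path m)" using assms by (rule pair_graph_forked)
  have "\<exists>S. connected_resolving_set (forked_path m) S \<and> card S = cdim (forked_path m)"
    unfolding cdim_def
    using LeastI[of "\<lambda>k. \<exists>S. connected_resolving_set (forked_path m) S \<and> card S = k"]
      connected_resolving_set_pverts[OF pg connected_forked[OF assms]] by blast
  then obtain S where S: "connected_resolving_set (forked_path m) S"
    "card S = cdim (forked_path m)" by blast
  then have "S \<subseteq> {..m + 4}" by (simp add: connected_resolving_set_def resolving_set_def)
  then have "finite S" by (rule finite_subset) simp
  then have "card {..m} \<le> card S" by (rule card_mono[OF _ path_subset_connected_resolving_set[OF assms S(1)]])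
  with S(2) show ?thesis by simp
qed

section \<open>The dimension with the shortcut\<close>

text \<open>
  On the cycle of odd length \<open>m + 1\<close> the distance to \<open>0\<close> determines a vertex up to the
  reflection that fixes \<open>0\<close>, and of two distinct mirror images only one is nearer to \<open>m\<close> than
  to \<open>0\<close>. All vertices outside the cycle are leaves; taking them into the set spares
  comparing them with cycle vertices.
\<close>

lemma cdim_shortcut_le:
  assumes m: "m = 2 * n" "0 < n"
  shows "cdim (shortcut_path m) \<le> 6"
proof -
  let ?G = "shortcut_path m"
  define S where "S = {0, m, m + 1, m + 2, m + 3, m + 4}"
  have pg: "pair_graph ?G" using m by (intro pair_graph_shortcut) simp
  interpret pair_graph ?G by (fact pg)
  \<comment> \<open>the distances to \<open>0\<close> and to \<open>m\<close>\<close>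
  define f where "f x = (if x \<le> m then min x (m + 1 - x) else if x \<le> m + 2 then 1 else 2)" for x
  define g where "g x = (if x \<le> m then min (m - x) (x + 1) else if x \<le> m + 2 then 2 else 1)" for x
  have f: "gdist ?G x 0 = ereal (real (f x))" if "x \<in> pverts ?G" for x
  proof (rule gdist_eqI[OF pair_wf_digraph_axioms _ _ _ that])
    show "f 0 = 0" by (simp add: f_def)
    show "f x \<le> Suc (f y)" if "(x, y) \<in> parcs ?G" for x y
      using that m by (auto simp: shortcut_arc_iff forked_arc_iff f_def min_def)
    show "\<exists>y. (x, y) \<in> parcs ?G \<and> f x = Suc (f y)" if x: "x \<in> pverts ?G" "x \<noteq> 0" for x
    proof -
      consider "x \<le> n" | "n < x" "x < m" | "x = m" | "x = m + 1 \<or> x = m + 2" | "x = m + 3 \<or> x = m + 4"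
        using x m by fastforce
      then show ?thesis
      proof cases
        case 1
        with x m show ?thesis by (intro exI[of _ "x - 1"]) (auto simp: shortcut_arc_iff forked_arc_iff f_def min_def)
      next
        case 2
        with x m show ?thesis by (intro exI[of _ "x + 1"]) (auto simp: shortcut_arc_iff forked_arc_iff f_def min_def)
      next
        case 3
        with m show ?thesis by (intro exI[of _ 0]) (auto simp: shortcut_arc_iff forked_arc_iff f_def min_def)
      next
        case 4
        with m show ?thesis by (intro exI[of _ 0]) (auto simp: shortcut_arc_iff forked_arc_iff f_def min_def)
      next
        case 5
        with m show ?thesis by (intro exI[of _ m]) (auto simp: shortcut_arc_iff forked_arc_iff f_def min_def)
      qed
    qed
  qed
  have g: "gdist ?G x m = ereal (real (g x))" if "x \<in> pverts ?G" for x
  proof (rule gdist_eqI[OF pair_wf_digraph_axioms _ _ _ that])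
    show "g m = 0" by (simp add: g_def)
    show "g x \<le> Suc (g y)" if "(x, y) \<in> parcs ?G" for x y
      using that m by (auto simp: shortcut_arc_iff forked_arc_iff g_def min_def)
    show "\<exists>y. (x, y) \<in> parcs ?G \<and> g x = Suc (g y)" if x: "x \<in> pverts ?G" "x \<noteq> m" for x
    proof -
      consider "x = 0" | "0 < x" "x < n" | "n \<le> x" "x < m" | "x = m + 1 \<or> x = m + 2" | "x = m + 3 \<or> x = m + 4"
        using x m by fastforce
      then show ?thesis
      proof cases
        case 1
        with m show ?thesis by (intro exI[of _ m]) (auto simp: shortcut_arc_iff forked_arc_iff g_def min_def)
      next
        case 2
        with x m show ?thesis by (intro exI[of _ "x - 1"]) (auto simp: shortcut_arc_iff forked_arc_iff g_def min_def)
      next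
        case 3
        with x m show ?thesis by (intro exI[of _ "x + 1"]) (auto simp: shortcut_arc_iff forked_arc_iff g_def min_def)
      next
        case 4
        with m show ?thesis by (intro exI[of _ 0]) (auto simp: shortcut_arc_iff forked_arc_iff g_def min_def)
      next
        case 5
        with m show ?thesis by (intro exI[of _ m]) (auto simp: shortcut_arc_iff forked_arc_iff g_def min_def)
      qed
    qed
  qed
  have "\<exists>z\<in>S. gdist ?G x z \<noteq> gdist ?G y z"
    if xy: "x \<in> pverts ?G" "y \<in> pverts ?G" "x \<noteq> y" for x y
  proof (cases "x \<in> S \<or> y \<in> S")
    case True
    with gdist_self_neq[OF pair_wf_digraph_axioms] xy show ?thesis by metis
  next
    case False
    have "x < m" using False xy(1) by (simp add: S_def) arith
    moreover have "y < m" using False xy(2) by (simp add: S_def) arith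
    ultimately have "f x \<noteq> f y \<or> g x \<noteq> g y"
      using m \<open>x \<noteq> y\<close> by (auto simp: f_def g_def min_def split: if_splits)
    then have "gdist ?G x 0 \<noteq> gdist ?G y 0 \<or> gdist ?G x m \<noteq> gdist ?G y m"
      using xy by (simp add: f g)
    then show ?thesis by (auto simp: S_def)
  qed
  then have "resolving_set ?G S"
    by (auto simp: resolving_set_def S_def)
  moreover have "Digraph_Component.connected (with_proj ?G \<restriction> S)"
    by (rule connected_induceI[OF pg, where f = id and r = 0])
      (use m in \<open>auto simp: S_def shortcut_arc_iff forked_arc_iff\<close>)
  ultimately have "cdim ?G \<le> card S"
    unfolding cdim_def by (intro Least_le) (auto simp: connected_resolving_set_def)
  also have "card S \<le> 6" unfolding S_def by (rule card_insert_le_m1 | simp)+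
  finally show ?thesis .
qed

theorem mainTheorem20:
  fixes N :: int
  shows "\<exists>(G :: nat pair_pre_digraph) u v.
    pair_graph G \<and> 2 \<le> card (pverts G) \<and>
    Digraph_Component.connected (with_proj G) \<and>
    (u, v) \<in> parcs G \<and>
    Digraph_Component.connected (with_proj (delete_edge G u v)) \<and>
    int (cdim (delete_edge G u v)) - int (cdim G) \<ge> N"
proof -
  define n where "n = nat N + 3"
  define m where "m = 2 * n"
  have m: "2 \<le> m" "0 < n" "N \<le> int (m + 1) - 6" by (auto simp: m_def n_def)
  show ?thesis
  proof (intro exI conjI)
    show "pair_graph (shortcut_path m)" using m by (intro pair_graph_shortcut) simp
    show "2 \<le> card (pverts (shortcut_path m))" by simp
    show "Digraph_Component.connected (with_proj (shortcut_path m))"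
      using m(1) by (rule connected_shortcut)
    show "(0, m) \<in> parcs (shortcut_path m)" by (simp add: shortcut_arc_iff forked_arc_iff)
    show "Digraph_Component.connected (with_proj (delete_edge (shortcut_path m) 0 m))"
      using m(1) by (simp add: delete_shortcut connected_forked)
    show "N \<le> int (cdim (delete_edge (shortcut_path m) 0 m)) - int (cdim (shortcut_path m))"
      using cdim_forked_ge[OF m(1)] cdim_shortcut_le[OF m_def m(2)] m
      by (simp add: delete_shortcut)
  qed
qed

end
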